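(* Let (S) denote the Hamiltonian system $\frac{dx}{dt}=\frac{\partial H}{\partial y}$, $\frac{dy}{dt}=-\frac{\partial H}{\partial x}$, $\frac{dz}{dt}=\frac{\partial H}{\partial w}$, $\frac{dw}{dt}=-\frac{\partial H}{\partial z}$ with $$H=H_{VI}(x,y,t;\alpha_0,\alpha_1,\alpha_2,\alpha_3,\alpha_4)+H_{VI}(z,w,t;\beta_0,\beta_1,\beta_2,\beta_3,\beta_4)+\frac{2(x-t)yz\{(z-1)w+\beta_2\}}{t(t-1)}.$$ Make the change of parameters and variables $$\alpha_0=\varepsilon^{-1},\quad \alpha_1=A_0,\quad \alpha_2=A_1,\quad \alpha_4-\beta_4=A_2,\quad \beta_2=A_3,\quad \beta_3=-\varepsilon^{-1}-(A_1+A_2+A_3-A_5),\quad \beta_4=A_4,$$ $$t=1-\varepsilon T,\quad x=\frac{X}{X-T},\quad z=\frac{Z}{Z-T},$$ $$y=-\frac{(X-T)\{(X-T)Y+A_1\}}{T},\quad w=-\frac{(Z-T)\{(Z-T)W+A_3\}}{T}$$ from $\alpha_0,\alpha_1,\alpha_2,\alpha_4-\beta_4,\beta_2,\beta_3,\beta_4,t,x,y,z,w$ to $A_0,\dots,A_5,\varepsilon,T,X,Y,Z,W$. Then (S) can also be written in the new variables $T,X,Y,Z,W$ and parameters $A_0,\dots,A_5,\varepsilon$ as a Hamiltonian system, and this new system tends, as $\varepsilon\to0$, to the system of type $A_5^{(1)}$ (given in the context) with parameters $A_0,\dots,A_5$, independent variable $T$ and unknowns $X,Y,Z,W$.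
   Context: For $\delta_0+\delta_1+2\delta_2+\delta_3+\delta_4=1$, $$H_{VI}(q,p,t;\delta_0,\dots,\delta_4)=\tfrac{1}{t(t-1)}\big[p^2(q-t)(q-1)q-\{(\delta_0-1)(q-1)q+\delta_3(q-t)q+\delta_4(q-t)(q-1)\}p+\delta_2(\delta_1+\delta_2)q\big].$$ The free parameters of (S) are complex numbers $\alpha_0,\alpha_1,\alpha_2,\alpha_4,\beta_2,\beta_3,\beta_4$ with $\alpha_0+\alpha_1+2\alpha_2+2(\alpha_4-\beta_4)+2\beta_2+\beta_3+\beta_4=1$ (which becomes $A_0+\cdots+A_5=1$); the other parameters are determined by $\alpha_3=\alpha_4-\beta_4+2\beta_2+\beta_3$, $\beta_0=\alpha_0+\alpha_4-\beta_4$, $\beta_1=\alpha_1+2\alpha_2+\alpha_4-\beta_4$. The system of type $A_5^{(1)}$ with parameters $A_0,\dots,A_5$, $\sum_iA_i=1$, is \begin{align*} \frac{dX}{dT}&=\frac{2X^2Y+2XZW}{T}-\frac{X^2}{T}-2XY-2ZW+\Big(1+\frac{A_1+A_3+A_5}{T}\Big)X+A_2+A_4,\\ \frac{dY}{dT}&=\frac{-2XY^2-2YZW}{T}+Y^2+\frac{2XY}{T}-\Big(1+\frac{A_1+A_3+A_5}{T}\Big)Y+\frac{A_1}{T},\\ \frac{dZ}{dT}&=\frac{2Z^2W+2XYZ}{T}-\frac{Z^2}{T}-2ZW-2YZ+\Big(1+\frac{A_1+A_3+A_5}{T}\Big)Z+A_4,\\ \frac{dW}{dT}&=\frac{-2ZW^2-2XYW}{T}+W^2+\frac{2ZW}{T}+2YW-\Big(1+\frac{A_1+A_3+A_5}{T}\Big)W+\frac{A_3}{T}.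 \end{align*} "Tends" means that the right-hand sides of the equations converge as $\varepsilon\to0$ with $A_0,\dots,A_5$ fixed. *)

theory Defs
  imports "HOL-Analysis.Analysis"
begin

text \<open>All times, unknowns and parameters are complex.\<close>

text \<open>The parameters are subject to \<open>\<delta>\<^sub>0 + \<delta>\<^sub>1 + 2 \<delta>\<^sub>2 + \<delta>\<^sub>3 + \<delta>\<^sub>4 = 1\<close>.\<close>

definition H_VI ::
  "complex \<Rightarrow> complex \<Rightarrow> complex \<Rightarrow> complex \<Rightarrow> complex \<Rightarrow> complex \<Rightarrow> complex \<Rightarrow> complex \<Rightarrow> complex" where
  "H_VI q p t \<delta>0 \<delta>1 \<delta>2 \<delta>3 \<delta>4 =
     1 / (t * (t - 1)) *
       (p\<^sup>2 * (q - t) * (q - 1) * q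
        - ((\<delta>0 - 1) * (q - 1) * q + \<delta>3 * (q - t) * q + \<delta>4 * (q - t) * (q - 1)) * p
        + \<delta>2 * (\<delta>1 + \<delta>2) * q)"

text \<open>The free parameters of the system (S).\<close>

definition S_parameters ::
  "complex \<Rightarrow> complex \<Rightarrow> complex \<Rightarrow> complex \<Rightarrow> complex \<Rightarrow> complex \<Rightarrow> complex \<Rightarrow> bool" where
  "S_parameters \<alpha>0 \<alpha>1 \<alpha>2 \<alpha>4 \<beta>2 \<beta>3 \<beta>4 \<longleftrightarrow>
     \<alpha>0 + \<alpha>1 + 2 * \<alpha>2 + 2 * (\<alpha>4 - \<beta>4) + 2 * \<beta>2 + \<beta>3 + \<beta>4 = 1"

text \<open>The Hamiltonian of (S).  Hamiltonians take the time as their first argument, followed by the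
  two canonical pairs \<open>(x, y)\<close> and \<open>(z, w)\<close>.\<close>

definition H_S ::
  "complex \<Rightarrow> complex \<Rightarrow> complex \<Rightarrow> complex \<Rightarrow> complex \<Rightarrow> complex \<Rightarrow> complex
   \<Rightarrow> complex \<Rightarrow> complex \<Rightarrow> complex \<Rightarrow> complex \<Rightarrow> complex \<Rightarrow> complex" where
  "H_S \<alpha>0 \<alpha>1 \<alpha>2 \<alpha>4 \<beta>2 \<beta>3 \<beta>4 t x y z w =
     (let \<alpha>3 = \<alpha>4 - \<beta>4 + 2 * \<beta>2 + \<beta>3;
          \<beta>0 = \<alpha>0 + \<alpha>4 - \<beta>4;
          \<beta>1 = \<alpha>1 + 2 * \<alpha>2 + \<alpha>4 - \<beta>4
      in H_VI x y t \<alpha>0 \<alpha>1 \<alpha>2 \<alpha>3 \<alpha>4 + H_VI z w t \<beta>0 \<beta>1 \<beta>2 \<beta>3 \<beta>4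
         + 2 * (x - t) * y * z * ((z - 1) * w + \<beta>2) / (t * (t - 1)))"

text \<open>\<open>(x, y, z, w)\<close> solves the Hamiltonian system of \<open>H\<close> at all times in \<open>U\<close>.  As \<open>deriv\<close> is
  total, this is meant for Hamiltonians that are holomorphic in the sense defined below.\<close>

definition hamiltonian_solution ::
  "(complex \<Rightarrow> complex \<Rightarrow> complex \<Rightarrow> complex \<Rightarrow> complex \<Rightarrow> complex) \<Rightarrow> complex set
   \<Rightarrow> (complex \<Rightarrow> complex) \<Rightarrow> (complex \<Rightarrow> complex) \<Rightarrow> (complex \<Rightarrow> complex) \<Rightarrow> (complex \<Rightarrow> complex) \<Rightarrow> bool" where
  "hamiltonian_solution H U x y z w \<longleftrightarrow> (\<forall>t\<in>U.
     (x has_field_derivative deriv (\<lambda>\<eta>. H t (x t) \<eta> (z t) (w t)) (y t)) (at t) \<and>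
     (y has_field_derivative - deriv (\<lambda>\<xi>. H t \<xi> (y t) (z t) (w t)) (x t)) (at t) \<and>
     (z has_field_derivative deriv (\<lambda>\<omega>. H t (x t) (y t) (z t) \<omega>) (w t)) (at t) \<and>
     (w has_field_derivative - deriv (\<lambda>\<zeta>. H t (x t) (y t) \<zeta> (w t)) (z t)) (at t))"

text \<open>Holomorphy in each variable separately, for times in \<open>S\<close> and on the whole phase space; by
  Hartogs' theorem this is joint holomorphy when \<open>S\<close> is open.\<close>

definition holomorphic_hamiltonian ::
  "(complex \<Rightarrow> complex \<Rightarrow> complex \<Rightarrow> complex \<Rightarrow> complex \<Rightarrow> complex) \<Rightarrow> complex set \<Rightarrow> bool" where
  "holomorphic_hamiltonian H S \<longleftrightarrow> (\<forall>x y z w.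
     (\<lambda>t. H t x y z w) holomorphic_on S \<and>
     (\<forall>t\<in>S. (\<lambda>\<xi>. H t \<xi> y z w) holomorphic_on UNIV \<and>
            (\<lambda>\<eta>. H t x \<eta> z w) holomorphic_on UNIV \<and>
            (\<lambda>\<zeta>. H t x y \<zeta> w) holomorphic_on UNIV \<and>
            (\<lambda>\<omega>. H t x y z \<omega>) holomorphic_on UNIV))"

definition change_of_parameters ::
  "complex \<Rightarrow> complex \<Rightarrow> complex \<Rightarrow> complex \<Rightarrow> complex \<Rightarrow> complex \<Rightarrow> complex
   \<Rightarrow> complex \<Rightarrow> complex \<Rightarrow> complex \<Rightarrow> complex \<Rightarrow> complex \<Rightarrow> complex \<Rightarrow> complex \<Rightarrow> bool" where
  "change_of_parameters A0 A1 A2 A3 A4 A5 \<epsilon> \<alpha>0 \<alpha>1 \<alpha>2 \<alpha>4 \<beta>2 \<beta>3 \<beta>4 \<longleftrightarrow>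
     \<alpha>0 = inverse \<epsilon> \<and> \<alpha>1 = A0 \<and> \<alpha>2 = A1 \<and> \<alpha>4 - \<beta>4 = A2 \<and> \<beta>2 = A3 \<and>
     \<beta>3 = - inverse \<epsilon> - (A1 + A2 + A3 - A5) \<and> \<beta>4 = A4"

definition change_of_variables ::
  "complex \<Rightarrow> complex \<Rightarrow> complex
   \<Rightarrow> complex \<Rightarrow> complex \<Rightarrow> complex \<Rightarrow> complex \<Rightarrow> complex
   \<Rightarrow> complex \<Rightarrow> complex \<Rightarrow> complex \<Rightarrow> complex \<Rightarrow> complex \<Rightarrow> bool" where
  "change_of_variables A1 A3 \<epsilon> t x y z w T X Y Z W \<longleftrightarrow>
     t = 1 - \<epsilon> * T \<and>
     x = X / (X - T) \<and>
     z = Z / (Z - T) \<and>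
     y = - ((X - T) * ((X - T) * Y + A1) / T) \<and>
     w = - ((Z - T) * ((Z - T) * W + A3) / T)"

text \<open>The right-hand sides of the system of type \<open>A\<^sub>5\<^sup>(\<^sup>1\<^sup>)\<close>, for \<open>X\<close>, \<open>Y\<close>, \<open>Z\<close>, \<open>W\<close> respectively.
  They depend on the parameters only through \<open>A\<^sub>1, \<dots>, A\<^sub>5\<close>.\<close>

definition A5_rhs_X where
  "A5_rhs_X A1 A2 A3 A4 A5 T X Y Z W =
     (2 * X\<^sup>2 * Y + 2 * X * Z * W) / T - X\<^sup>2 / T - 2 * X * Y - 2 * Z * W
     + (1 + (A1 + A3 + A5) / T) * X + A2 + (A4 :: complex)"

definition A5_rhs_Y where
  "A5_rhs_Y A1 A2 A3 A4 A5 T X Y Z W =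
     (- 2 * X * Y\<^sup>2 - 2 * Y * Z * W) / T + Y\<^sup>2 + 2 * X * Y / T
     - (1 + (A1 + A3 + A5) / T) * Y + (A1 :: complex) / T"

definition A5_rhs_Z where
  "A5_rhs_Z A1 A2 A3 A4 A5 T X Y Z W =
     (2 * Z\<^sup>2 * W + 2 * X * Y * Z) / T - Z\<^sup>2 / T - 2 * Z * W - 2 * Y * Z
     + (1 + (A1 + A3 + A5) / T) * Z + (A4 :: complex)"

definition A5_rhs_W where
  "A5_rhs_W A1 A2 A3 A4 A5 T X Y Z W =
     (- 2 * Z * W\<^sup>2 - 2 * X * Y * W) / T + W\<^sup>2 + 2 * Z * W / T + 2 * Y * W
     - (1 + (A1 + A3 + A5) / T) * W + (A3 :: complex) / T"

lemma S_parameters_iff: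
  assumes "change_of_parameters A0 A1 A2 A3 A4 A5 \<epsilon> \<alpha>0 \<alpha>1 \<alpha>2 \<alpha>4 \<beta>2 \<beta>3 \<beta>4"
  shows "S_parameters \<alpha>0 \<alpha>1 \<alpha>2 \<alpha>4 \<beta>2 \<beta>3 \<beta>4 \<longleftrightarrow> A0 + A1 + A2 + A3 + A4 + A5 = 1"
  using assms unfolding change_of_parameters_def S_parameters_def
  by (auto simp: algebra_simps)

text \<open>The change of variables is a bijection between the points with \<open>X \<noteq> T\<close>, \<open>Z \<noteq> T\<close> and those with
  \<open>x \<noteq> 1\<close>, \<open>z \<noteq> 1\<close>.\<close>

lemma change_of_variables_iff:
  assumes "T \<noteq> 0"
  shows "change_of_variables A1 A3 \<epsilon> t x y z w T X Y Z W \<and> X \<noteq> T \<and> Z \<noteq> T \<longleftrightarrow>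
    t = 1 - \<epsilon> * T \<and> x \<noteq> 1 \<and> z \<noteq> 1 \<and>
    X = T * x / (x - 1) \<and> Z = T * z / (z - 1) \<and>
    Y = - (x - 1) * ((x - 1) * y + A1) / T \<and>
    W = - (z - 1) * ((z - 1) * w + A3) / T"
proof -
  have 1: "x = X / (X - T) \<and> X \<noteq> T \<longleftrightarrow> x \<noteq> 1 \<and> X = T * x / (x - 1)" for x X
    using assms by (auto simp: field_simps)
  have 2: "y = - ((X - T) * ((X - T) * Y + A) / T) \<longleftrightarrow> Y = - (x - 1) * ((x - 1) * y + A) / T"
    if "x \<noteq> 1" "X = T * x / (x - 1)" for x y X Y A
  proof -
    define u where "u = x - 1"
    have u: "u \<noteq> 0" "X - T = T / u"
      using that unfolding u_def by (auto simp: field_simps)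
    have e: "(X - T) * ((X - T) * Y + A) / T = (T * Y + A * u) / u\<^sup>2"
      unfolding u(2) using assms u(1) by (simp add: divide_simps power2_eq_square)
    have "y = - ((T * Y + A * u) / u\<^sup>2) \<longleftrightarrow> u\<^sup>2 * y = - (T * Y + A * u)"
      using u(1) by (auto simp: field_simps)
    also have "\<dots> \<longleftrightarrow> T * Y = - u * (u * y + A)"
      by (auto simp: power2_eq_square algebra_simps eq_neg_iff_add_eq_0)
    also have "\<dots> \<longleftrightarrow> Y = - u * (u * y + A) / T"
      using assms by (simp only: eq_divide_eq) (simp add: mult.commute)
    finally show ?thesis
      unfolding e u_def[symmetric] .
  qed
  show ?thesis
    unfolding change_of_variables_def using 1[of x X] 1[of z Z] 2[of x X y Y A1] 2[of z Z w W A3]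
    by blast
qed

end

theory Submission
  imports Defs
begin

text \<open>For fixed \<open>T\<close> the map \<open>(X, Y) \<mapsto> (x, y)\<close> is symplectic, and so is \<open>(Z, W) \<mapsto> (z, w)\<close>; hence (S)
  becomes a Hamiltonian system again.  Its vector field, computed by the chain rule, turns out to be
  polynomial in \<open>X, Y, Z, W\<close>: the poles at \<open>X = T\<close> and \<open>Z = T\<close> cancel, and so do the terms
  in \<open>1 / \<epsilon>\<close>, since \<open>\<alpha>\<^sub>0\<close> and \<open>\<beta>\<^sub>3\<close> have opposite poles in \<open>\<epsilon>\<close>.  Integrating the vector field gives a
  Hamiltonian of the form \<open>(K\<^sub>0 + \<epsilon> K\<^sub>1) / (T (1 - \<epsilon> T))\<close>, whose limit is \<open>K\<^sub>0 / T\<close>.\<close>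

section \<open>The Hamiltonian in the new variables and its partial derivatives\<close>

text \<open>A Hamiltonian is fixed only up to a function of \<open>T\<close>; this one vanishes at
  the origin of phase space. \<open>A0\<close> is eliminated through the normalisation of the
  parameters.\<close>

definition confluent_hamiltonian ::
  "complex \<Rightarrow> complex \<Rightarrow> complex \<Rightarrow> complex \<Rightarrow> complex
   \<Rightarrow> complex \<Rightarrow> complex \<Rightarrow> complex \<Rightarrow> complex \<Rightarrow> complex \<Rightarrow> complex \<Rightarrow> complex" where
  "confluent_hamiltonian A1 A2 A3 A4 A5 \<epsilon> T X Y Z W =
     (X * Y\<^sup>2 * (X - T) + Z * W\<^sup>2 * (Z - T) + 2 * Y * Z * W * (X - T)
      + Y * (X * (A1 + A3 + A5 + T) - X\<^sup>2 + (A2 + A4) * T)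
      + W * (Z * (A1 + A3 + A5 + T) - Z\<^sup>2 + A4 * T) - A1 * X - A3 * Z
      + \<epsilon> * (X * Y\<^sup>2 * (X - T)\<^sup>2 + Z * W\<^sup>2 * (Z - T)\<^sup>2 + 2 * Y * Z * W * (X - T)\<^sup>2
         + Y * ((X - T) * ((A1 + A3 + A5) * X + (A2 + A4) * T) - T * X)
         + W * ((Z - T) * ((A3 + A5 - A1 - A2) * Z + A4 * T) + 2 * A1 * (X - T) * Z - T * Z)
         + A1 * (A3 + A5) * X + A3 * (A5 - A1 - A2) * Z))
     / (T * (1 - \<epsilon> * T))"

text \<open>The denominator does not contain the differentiated variable, so
  \<open>DERIV_cdivide\<close> splits it off and only polynomials are differentiated. The numerator
  keeps the shape \<open>a + \<epsilon> * b\<close>, which the limit rules below match by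
  unification.\<close>

lemma deriv_confluent_hamiltonian_Y:
  "deriv (\<lambda>\<eta>. confluent_hamiltonian A1 A2 A3 A4 A5 \<epsilon> T X \<eta> Z W) Y =
     (2 * (X - T) * (X * Y + Z * W) + X * (A1 + A3 + A5 + T) - X\<^sup>2 + (A2 + A4) * T
      + \<epsilon> * (2 * (X - T)\<^sup>2 * (X * Y + Z * W)
         + (X - T) * ((A1 + A3 + A5) * X + (A2 + A4) * T) - T * X))
     / (T * (1 - \<epsilon> * T))"
  unfolding confluent_hamiltonian_def
  by (rule DERIV_imp_deriv DERIV_cdivide)+
    (rule derivative_eq_intros refl | simp add: algebra_simps power2_eq_square)+

lemma deriv_confluent_hamiltonian_X:
  "deriv (\<lambda>\<xi>. confluent_hamiltonian A1 A2 A3 A4 A5 \<epsilon> T \<xi> Y Z W) X =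
     (Y\<^sup>2 * (2 * X - T) + 2 * Y * Z * W + Y * (A1 + A3 + A5 + T - 2 * X) - A1
      + \<epsilon> * (Y\<^sup>2 * (X - T) * (3 * X - T) + 4 * Y * Z * W * (X - T)
         + Y * ((A1 + A3 + A5) * (2 * X - T) + (A2 + A4) * T - T)
         + 2 * A1 * Z * W + A1 * (A3 + A5)))
     / (T * (1 - \<epsilon> * T))"
  unfolding confluent_hamiltonian_def
  by (rule DERIV_imp_deriv DERIV_cdivide)+
    (rule derivative_eq_intros refl | simp add: algebra_simps power2_eq_square)+

lemma deriv_confluent_hamiltonian_W:
  "deriv (\<lambda>\<omega>. confluent_hamiltonian A1 A2 A3 A4 A5 \<epsilon> T X Y Z \<omega>) W =
     (2 * Z * W * (Z - T) + 2 * Y * Z * (X - T) + Z * (A1 + A3 + A5 + T) - Z\<^sup>2 + A4 * T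
      + \<epsilon> * (2 * Z * W * (Z - T)\<^sup>2 + 2 * Y * Z * (X - T)\<^sup>2
         + (Z - T) * ((A3 + A5 - A1 - A2) * Z + A4 * T) + 2 * A1 * (X - T) * Z - T * Z))
     / (T * (1 - \<epsilon> * T))"
  unfolding confluent_hamiltonian_def
  by (rule DERIV_imp_deriv DERIV_cdivide)+
    (rule derivative_eq_intros refl | simp add: algebra_simps power2_eq_square)+

lemma deriv_confluent_hamiltonian_Z:
  "deriv (\<lambda>\<zeta>. confluent_hamiltonian A1 A2 A3 A4 A5 \<epsilon> T X Y \<zeta> W) Z =
     (W\<^sup>2 * (2 * Z - T) + 2 * Y * W * (X - T) + W * (A1 + A3 + A5 + T - 2 * Z) - A3
      + \<epsilon> * (W\<^sup>2 * (Z - T) * (3 * Z - T) + 2 * Y * W * (X - T)\<^sup>2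
         + W * ((A3 + A5 - A1 - A2) * (2 * Z - T) + A4 * T + 2 * A1 * (X - T) - T)
         + A3 * (A5 - A1 - A2)))
     / (T * (1 - \<epsilon> * T))"
  unfolding confluent_hamiltonian_def
  by (rule DERIV_imp_deriv DERIV_cdivide)+
    (rule derivative_eq_intros refl | simp add: algebra_simps power2_eq_square)+

lemma holomorphic_confluent_hamiltonian:
  "holomorphic_hamiltonian (confluent_hamiltonian A1 A2 A3 A4 A5 \<epsilon>) {T. T \<noteq> 0 \<and> \<epsilon> * T \<noteq> 1}"
  unfolding holomorphic_hamiltonian_def confluent_hamiltonian_def
  by (auto intro!: holomorphic_intros)

section \<open>The limit of the vector field as \<open>\<epsilon>\<close> tends to 0\<close>

text \<open>The limit \<open>c\<close> is a separate variable with its value as a premise: the rule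
  then accepts the right-hand sides of the limit system as they are written and leaves an identity
  of rational functions.\<close>

lemma tendsto_div_confluent:
  fixes a b c T :: complex
  assumes "T \<noteq> 0" "c = a / T"
  shows "((\<lambda>\<epsilon>. (a + \<epsilon> * b) / (T * (1 - \<epsilon> * T))) \<longlongrightarrow> c) (at 0)"
  using assms by (auto intro!: tendsto_eq_intros)

lemma tendsto_minus_div_confluent:
  fixes a b c T :: complex
  assumes "T \<noteq> 0" "c = - a / T"
  shows "((\<lambda>\<epsilon>. - ((a + \<epsilon> * b) / (T * (1 - \<epsilon> * T)))) \<longlongrightarrow> c) (at 0)"
  using assms by (auto intro!: tendsto_eq_intros)

lemma confluent_hamiltonian_limit:
  fixes A1 A2 A3 A4 A5 :: complex
  assumes "T \<noteq> 0"
  defines "K \<equiv> confluent_hamiltonian A1 A2 A3 A4 A5"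
  shows
    "((\<lambda>\<epsilon>. deriv (\<lambda>\<eta>. K \<epsilon> T X \<eta> Z W) Y) \<longlongrightarrow> A5_rhs_X A1 A2 A3 A4 A5 T X Y Z W) (at 0)"
    "((\<lambda>\<epsilon>. - deriv (\<lambda>\<xi>. K \<epsilon> T \<xi> Y Z W) X) \<longlongrightarrow> A5_rhs_Y A1 A2 A3 A4 A5 T X Y Z W) (at 0)"
    "((\<lambda>\<epsilon>. deriv (\<lambda>\<omega>. K \<epsilon> T X Y Z \<omega>) W) \<longlongrightarrow> A5_rhs_Z A1 A2 A3 A4 A5 T X Y Z W) (at 0)"
    "((\<lambda>\<epsilon>. - deriv (\<lambda>\<zeta>. K \<epsilon> T X Y \<zeta> W) Z) \<longlongrightarrow> A5_rhs_W A1 A2 A3 A4 A5 T X Y Z W) (at 0)"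
  unfolding K_def deriv_confluent_hamiltonian_X deriv_confluent_hamiltonian_Y
    deriv_confluent_hamiltonian_Z deriv_confluent_hamiltonian_W
    A5_rhs_X_def A5_rhs_Y_def A5_rhs_Z_def A5_rhs_W_def
  by (rule tendsto_div_confluent tendsto_minus_div_confluent; use assms in
      \<open>simp add: field_simps power2_eq_square\<close>)+

section \<open>The chain rule for one canonical pair\<close>

text \<open>The chain rule for \<open>X = T * x / (x - 1)\<close>,
  \<open>Y = - (x - 1) * ((x - 1) * y + A) / T\<close> and \<open>t = 1 - \<epsilon> * T\<close>:
  the summands without \<open>a\<close> and \<open>b\<close> come from the explicit dependence on
  \<open>T\<close>, the others from the Jacobian matrix times \<open>- \<epsilon>\<close>. The
  velocities \<open>a\<close> and \<open>b\<close> are arbitrary numbers, so the lemma serves both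
  pairs, whatever couples them.\<close>

lemma derivatives_change_of_variables:
  fixes x y X Y :: "complex \<Rightarrow> complex"
  assumes \<epsilon>: "\<epsilon> \<noteq> 0" and U: "open U" "T \<in> U"
    and cv: "\<And>s. s \<in> U \<Longrightarrow> s \<noteq> 0 \<and> X s \<noteq> s \<and> x (1 - \<epsilon> * s) = X s / (X s - s) \<and>
      y (1 - \<epsilon> * s) = - ((X s - s) * ((X s - s) * Y s + A) / s)"
  shows
    "(x has_field_derivative a) (at (1 - \<epsilon> * T)) \<and> (y has_field_derivative b) (at (1 - \<epsilon> * T)) \<longleftrightarrow>
     (X has_field_derivative X T / T + \<epsilon> * (X T - T)\<^sup>2 / T * a) (at T) \<and>
     (Y has_field_derivative - Y T / T - \<epsilon> * (2 * (X T - T) * Y T + A) / T * a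
        + \<epsilon> * T / (X T - T)\<^sup>2 * b) (at T)"
    (is "?L \<longleftrightarrow> ?R")
proof -
  define p where "p = X T - T"
  have nz: "T \<noteq> 0" "p \<noteq> 0" and XT: "X T = p + T"
    using cv[OF U(2)] by (auto simp: p_def)
  show ?thesis
  proof
    assume L: ?L
    \<comment> \<open>\<open>\<xi>\<close> and \<open>\<eta>\<close> are \<open>x\<close> and
      \<open>y\<close> as functions of the new time; the formulas of
      \<open>change_of_variables_iff\<close> then recover \<open>X\<close> and \<open>Y\<close> from
      them.\<close>
    define \<xi> where "\<xi> s = x (1 - \<epsilon> * s)" for s
    define \<eta> where "\<eta> s = y (1 - \<epsilon> * s)" for s
    have inner: "((\<lambda>s. 1 - \<epsilon> * s) has_field_derivative - \<epsilon>) (at T)"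
      by (auto intro!: derivative_eq_intros)
    have \<xi>: "(\<xi> has_field_derivative a * - \<epsilon>) (at T)" and \<eta>: "(\<eta> has_field_derivative b * - \<epsilon>) (at T)"
      unfolding \<xi>_def \<eta>_def using L DERIV_chain2[OF _ inner] by blast+
    have \<xi>T: "\<xi> T = 1 + T / p" and \<eta>T: "\<eta> T = - (p * (p * Y T + A) / T)"
      using cv[OF U(2)] nz by (auto simp: \<xi>_def \<eta>_def p_def field_simps)
    have "((\<lambda>s. s * \<xi> s / (\<xi> s - 1)) has_field_derivative X T / T + \<epsilon> * p\<^sup>2 / T * a) (at T)"
      using nz unfolding XT
      by (auto intro!: derivative_eq_intros \<xi> simp: \<xi>T) (simp add: field_simps power2_eq_square)
    moreover have "((\<lambda>s. - (\<xi> s - 1) * ((\<xi> s - 1) * \<eta> s + A) / s) has_field_derivative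
        - Y T / T - \<epsilon> * (2 * p * Y T + A) / T * a + \<epsilon> * T / p\<^sup>2 * b) (at T)"
      using nz
      by (auto intro!: derivative_eq_intros \<xi> \<eta> simp: \<xi>T \<eta>T) (simp add: field_simps power2_eq_square)
    \<comment> \<open>These identities are needed on all of \<open>U\<close>, since a derivative
      carries over only between functions that agree near \<open>T\<close>.\<close>
    moreover have "s * \<xi> s / (\<xi> s - 1) = X s" "- (\<xi> s - 1) * ((\<xi> s - 1) * \<eta> s + A) / s = Y s"
      if "s \<in> U" for s
    proof -
      define r where "r = X s - s"
      have nz: "s \<noteq> 0" "r \<noteq> 0" using cv[OF that] by (auto simp: r_def)
      have r: "\<xi> s = 1 + s / r" "X s = r + s" "\<eta> s = - (r * (r * Y s + A) / s)"
        using cv[OF that] by (auto simp: \<xi>_def \<eta>_def r_def field_simps)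
      show "s * \<xi> s / (\<xi> s - 1) = X s" "- (\<xi> s - 1) * ((\<xi> s - 1) * \<eta> s + A) / s = Y s"
        unfolding r using nz by (auto simp: field_simps power2_eq_square)
    qed
    ultimately show ?R
      unfolding p_def using has_field_derivative_transform_within_open[OF _ U] by blast
  next
    assume R: ?R
    \<comment> \<open>The converse uses the inverse time change \<open>\<tau>\<close> and
      differentiates the formulas for \<open>x\<close> and \<open>y\<close> themselves; the preimage
      of \<open>U\<close> under \<open>\<tau>\<close> is the neighbourhood on which they
      hold.\<close>
    define \<tau> where "\<tau> t = (1 - t) / \<epsilon>" for t
    define t where "t = 1 - \<epsilon> * T"
    have \<tau>t: "\<tau> t = T"
      using \<epsilon> by (simp add: \<tau>_def t_def)
    have inner: "(\<tau> has_field_derivative - 1 / \<epsilon>) (at t)"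
      unfolding \<tau>_def using \<epsilon> by (auto intro!: derivative_eq_intros)
    have "continuous_on UNIV \<tau>"
      unfolding \<tau>_def using \<epsilon> by (auto intro!: continuous_intros)
    then have V: "open (\<tau> -` U)" "t \<in> \<tau> -` U"
      using U by (auto simp: open_vimage \<tau>t)
    define F where "F s = X (\<tau> s)" for s
    define G where "G s = Y (\<tau> s)" for s
    have F: "(F has_field_derivative ((p + T) / T + \<epsilon> * p\<^sup>2 / T * a) * (- 1 / \<epsilon>)) (at t)"
      and G: "(G has_field_derivative (- Y T / T - \<epsilon> * (2 * p * Y T + A) / T * a
        + \<epsilon> * T / p\<^sup>2 * b) * (- 1 / \<epsilon>)) (at t)"
      unfolding F_def G_def using R DERIV_chain2[OF _ inner, unfolded \<tau>t]
      unfolding XT p_def[symmetric] by (simp_all only: add_diff_cancel_right')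
    have Ft: "F t = p + T" "G t = Y T"
      by (auto simp: F_def G_def \<tau>t XT)
    have "((\<lambda>s. F s / (F s - \<tau> s)) has_field_derivative a) (at t)"
      using nz \<epsilon>
      by (auto intro!: derivative_eq_intros F inner simp: Ft \<tau>t) (simp add: field_simps power2_eq_square)
    moreover have "((\<lambda>s. - ((F s - \<tau> s) * ((F s - \<tau> s) * G s + A) / \<tau> s))
        has_field_derivative b) (at t)"
      using nz \<epsilon>
      by (auto intro!: derivative_eq_intros F G inner simp: Ft \<tau>t) (simp add: field_simps power2_eq_square)
    moreover have "F s / (F s - \<tau> s) = x s" "- ((F s - \<tau> s) * ((F s - \<tau> s) * G s + A) / \<tau> s) = y s"
      if "s \<in> \<tau> -` U" for s
    proof -
      have "1 - \<epsilon> * \<tau> s = s"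
        using \<epsilon> by (simp add: \<tau>_def)
      then show "F s / (F s - \<tau> s) = x s" "- ((F s - \<tau> s) * ((F s - \<tau> s) * G s + A) / \<tau> s) = y s"
        using cv[of "\<tau> s"] that by (auto simp: F_def G_def)
    qed
    ultimately show ?L
      unfolding t_def[symmetric] using has_field_derivative_transform_within_open[OF _ V] by blast
  qed
qed

section \<open>The Hamiltonian of (S) after the change of parameters\<close>

text \<open>The poles of \<open>\<alpha>0\<close> and \<open>\<alpha>3\<close> combine to
  \<open>inverse \<epsilon> * ((x - 1) * x - (x - t) * x)\<close>, which is \<open>- T * x\<close>,
  and likewise for \<open>z\<close>. The only \<open>\<epsilon>\<close> left in a denominator comes
  from \<open>t * (t - 1)\<close>.\<close>

lemma H_S_confluent:
  assumes "\<epsilon> \<noteq> 0"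
  shows "H_S (inverse \<epsilon>) A0 A1 (A2 + A4) A3 (- inverse \<epsilon> - (A1 + A2 + A3 - A5)) A4 (1 - \<epsilon> * T) x y z w =
    - (let t = 1 - \<epsilon> * T in
        y\<^sup>2 * (x - t) * (x - 1) * x
        + (T * x + (x - 1) * x - (A3 + A5 - A1) * (x - t) * x - (A2 + A4) * (x - t) * (x - 1)) * y
        + A1 * (A0 + A1) * x
        + w\<^sup>2 * (z - t) * (z - 1) * z
        + (T * z - (A2 - 1) * (z - 1) * z - (A5 - A1 - A2 - A3) * (z - t) * z - A4 * (z - t) * (z - 1)) * w
        + A3 * (A0 + 2 * A1 + A2 + A3) * z
        + 2 * (x - t) * y * z * ((z - 1) * w + A3)) / (\<epsilon> * T * (1 - \<epsilon> * T))"
proof -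
  \<comment> \<open>With the inverses \<open>i\<close> and \<open>k\<close> as indeterminates, tied
    only by \<open>i * (t - 1) = - T\<close>, the claim is a polynomial identity.\<close>
  define i where "i = inverse \<epsilon>"
  define t where "t = 1 - \<epsilon> * T"
  have i: "i * (t - 1) = - T"
    using assms by (simp add: i_def t_def)
  have d: "t * (t - 1) = - (\<epsilon> * T * t)"
    by (simp add: t_def algebra_simps)
  define k where "k = inverse (\<epsilon> * T * t)"
  show ?thesis
    unfolding H_S_def H_VI_def Let_def i_def[symmetric] t_def[symmetric]
    unfolding d divide_inverse inverse_minus_eq k_def[symmetric]
    using i by algebra
qed

context
  fixes A0 A1 A2 A3 A4 A5 \<epsilon> T :: complex
  assumes \<epsilon>: "\<epsilon> \<noteq> 0"
begin

abbreviation (input) H_S' where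
  "H_S' \<equiv> H_S (inverse \<epsilon>) A0 A1 (A2 + A4) A3 (- inverse \<epsilon> - (A1 + A2 + A3 - A5)) A4 (1 - \<epsilon> * T)"

lemma deriv_H_S_y:
  "deriv (\<lambda>\<eta>. H_S' x \<eta> z w) y =
    - (let t = 1 - \<epsilon> * T in
        2 * y * (x - t) * (x - 1) * x
        + T * x + (x - 1) * x - (A3 + A5 - A1) * (x - t) * x - (A2 + A4) * (x - t) * (x - 1)
        + 2 * (x - t) * z * ((z - 1) * w + A3)) / (\<epsilon> * T * (1 - \<epsilon> * T))"
  unfolding H_S_confluent[OF \<epsilon>] Let_def
  by (rule DERIV_imp_deriv DERIV_cdivide DERIV_minus)+
    (rule derivative_eq_intros refl | simp add: algebra_simps)+

lemma deriv_H_S_x: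
  "deriv (\<lambda>\<xi>. H_S' \<xi> y z w) x =
    - (let t = 1 - \<epsilon> * T in
        y\<^sup>2 * ((x - 1) * x + (x - t) * x + (x - t) * (x - 1))
        + (T + 2 * x - 1 - (A3 + A5 - A1) * (2 * x - t) - (A2 + A4) * (2 * x - 1 - t)) * y
        + A1 * (A0 + A1)
        + 2 * y * z * ((z - 1) * w + A3)) / (\<epsilon> * T * (1 - \<epsilon> * T))"
  unfolding H_S_confluent[OF \<epsilon>] Let_def
  by (rule DERIV_imp_deriv DERIV_cdivide DERIV_minus)+
    (rule derivative_eq_intros refl | simp add: algebra_simps)+

lemma deriv_H_S_w:
  "deriv (\<lambda>\<omega>. H_S' x y z \<omega>) w =
    - (let t = 1 - \<epsilon> * T in
        2 * w * (z - t) * (z - 1) * z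
        + T * z - (A2 - 1) * (z - 1) * z - (A5 - A1 - A2 - A3) * (z - t) * z - A4 * (z - t) * (z - 1)
        + 2 * (x - t) * y * z * (z - 1)) / (\<epsilon> * T * (1 - \<epsilon> * T))"
  unfolding H_S_confluent[OF \<epsilon>] Let_def
  by (rule DERIV_imp_deriv DERIV_cdivide DERIV_minus)+
    (rule derivative_eq_intros refl | simp add: algebra_simps)+

lemma deriv_H_S_z:
  "deriv (\<lambda>\<zeta>. H_S' x y \<zeta> w) z =
    - (let t = 1 - \<epsilon> * T in
        w\<^sup>2 * ((z - 1) * z + (z - t) * z + (z - t) * (z - 1))
        + (T - (A2 - 1) * (2 * z - 1) - (A5 - A1 - A2 - A3) * (2 * z - t) - A4 * (2 * z - 1 - t)) * w
        + A3 * (A0 + 2 * A1 + A2 + A3)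
        + 2 * (x - t) * y * ((2 * z - 1) * w + A3)) / (\<epsilon> * T * (1 - \<epsilon> * T))"
  unfolding H_S_confluent[OF \<epsilon>] Let_def
  by (rule DERIV_imp_deriv DERIV_cdivide DERIV_minus)+
    (rule derivative_eq_intros refl | simp add: algebra_simps)+

end

section \<open>Transport of the vector field of (S) to the new variables\<close>

text \<open>The right-hand sides are those of \<open>derivatives_change_of_variables\<close> with
  the Hamiltonian velocities of (S) for \<open>a\<close> and \<open>b\<close>. Clearing powers of
  \<open>X - T\<close> and \<open>Z - T\<close> reduces everything to polynomial identities.\<close>

lemma vector_field_change_of_variables:
  fixes A0 A1 A2 A3 A4 A5 \<epsilon> T x y z w X Y Z W :: complex
  assumes sum: "A0 + A1 + A2 + A3 + A4 + A5 = 1"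
    and nz: "\<epsilon> \<noteq> 0" "T \<noteq> 0" "X \<noteq> T" "Z \<noteq> T" "\<epsilon> * T \<noteq> 1"
    and cv: "change_of_variables A1 A3 \<epsilon> (1 - \<epsilon> * T) x y z w T X Y Z W"
  defines "H \<equiv> H_S (inverse \<epsilon>) A0 A1 (A2 + A4) A3 (- inverse \<epsilon> - (A1 + A2 + A3 - A5)) A4 (1 - \<epsilon> * T)"
  and "K \<equiv> confluent_hamiltonian A1 A2 A3 A4 A5 \<epsilon> T"
  shows
  "deriv (\<lambda>\<eta>. K X \<eta> Z W) Y = X / T + \<epsilon> * (X - T)\<^sup>2 / T * deriv (\<lambda>\<eta>. H x \<eta> z w) y" (is ?A)
  "- deriv (\<lambda>\<xi>. K \<xi> Y Z W) X = - Y / T - \<epsilon> * (2 * (X - T) * Y + A1) / T * deriv (\<lambda>\<eta>. H x \<eta> z w) y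
        + \<epsilon> * T / (X - T)\<^sup>2 * - deriv (\<lambda>\<xi>. H \<xi> y z w) x" (is ?B)
  "deriv (\<lambda>\<omega>. K X Y Z \<omega>) W = Z / T + \<epsilon> * (Z - T)\<^sup>2 / T * deriv (\<lambda>\<omega>. H x y z \<omega>) w" (is ?C)
  "- deriv (\<lambda>\<zeta>. K X Y \<zeta> W) Z = - W / T - \<epsilon> * (2 * (Z - T) * W + A3) / T * deriv (\<lambda>\<omega>. H x y z \<omega>) w
        + \<epsilon> * T / (Z - T)\<^sup>2 * - deriv (\<lambda>\<zeta>. H x y \<zeta> w) z" (is ?D)
proof -
  define p where "p = X - T"
  define q where "q = Z - T"
  define r where "r = 1 - \<epsilon> * T"
  \<comment> \<open>\<open>g\<close> and \<open>h\<close> are defined so that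
    \<open>x - t = T * g / p\<close> and \<open>z - t = T * h / q\<close>; both become 1 at
    \<open>\<epsilon> = 0\<close>, where the points \<open>t\<close> and 1 merge.\<close>
  define g where "g = 1 + \<epsilon> * p"
  define h where "h = 1 + \<epsilon> * q"
  have nz': "p \<noteq> 0" "q \<noteq> 0" "r \<noteq> 0"
    using nz by (auto simp: p_def q_def r_def)
  have X: "X = p + T" and Z: "Z = q + T"
    by (auto simp: p_def q_def)
  have y: "y = - (p * (p * Y + A1) / T)" and w: "w = - (q * (q * W + A3) / T)"
    and x: "x = X / p" and z: "z = Z / q"
    using cv by (auto simp: change_of_variables_def p_def q_def)
  have x1: "x - 1 = T / p" "x - (1 - \<epsilon> * T) = T * g / p"
    and z1: "z - 1 = T / q" "z - (1 - \<epsilon> * T) = T * h / q"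
    unfolding x z X Z g_def h_def using nz' by (auto simp: field_simps)
  \<comment> \<open>The shift by \<open>A3\<close> in the formula for \<open>w\<close> turns this
    factor of the coupling term into a plain product, which keeps poles at \<open>Z = T\<close> out
    of the equations for \<open>X\<close> and \<open>Y\<close>.\<close>
  have zw: "z * ((z - 1) * w + A3) = - (Z * W)"
    unfolding z1 unfolding w z unfolding Z using nz nz' by (auto simp: field_simps)
  note d = deriv_H_S_x[OF nz(1)] deriv_H_S_y[OF nz(1)] deriv_H_S_z[OF nz(1)] deriv_H_S_w[OF nz(1)]
    deriv_confluent_hamiltonian_X deriv_confluent_hamiltonian_Y
    deriv_confluent_hamiltonian_Z deriv_confluent_hamiltonian_W
  \<comment> \<open>\<open>hx, hy, hz, hw\<close> are \<open>- \<epsilon> T (1 - \<epsilon> T)\<close> times the partial derivatives of \<open>H\<close>, and \<open>Ex, Ey, Ez, Ew\<close>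
    are what remains of them, free of denominators, in the new coordinates.\<close>
  define hy where "hy = (let t = 1 - \<epsilon> * T in
        2 * y * (x - t) * (x - 1) * x
        + T * x + (x - 1) * x - (A3 + A5 - A1) * (x - t) * x - (A2 + A4) * (x - t) * (x - 1)
        + 2 * (x - t) * z * ((z - 1) * w + A3))"
  define Ey where "Ey = X * p + X - (A3 + A5 - A1) * g * X
     - (A2 + A4) * T * g - 2 * (p * Y + A1) * g * X - 2 * p * g * Z * W"
  have hy: "hy = T * Ey / p\<^sup>2"
    unfolding hy_def Ey_def Let_def mult.assoc[of _ z] zw x1 unfolding y x
    using nz(1,2) nz' by (simp add: field_simps power2_eq_square)
  define hw where "hw = (let t = 1 - \<epsilon> * T in
        2 * w * (z - t) * (z - 1) * z
        + T * z - (A2 - 1) * (z - 1) * z - (A5 - A1 - A2 - A3) * (z - t) * z - A4 * (z - t) * (z - 1)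
        + 2 * (x - t) * y * z * (z - 1))"
  define Ew where "Ew = Z * q - (A2 - 1) * Z - (A5 - A1 - A2 - A3) * h * Z - A4 * T * h
     - 2 * (q * W + A3) * h * Z - 2 * g * (p * Y + A1) * Z"
  have hw: "hw = T * Ew / q\<^sup>2"
    unfolding hw_def Ew_def Let_def x1 z1 unfolding y w z
    using nz(1,2) nz' by (simp add: field_simps power2_eq_square)
  \<comment> \<open>The Jacobian factor \<open>p\<^sup>2\<close> absorbs the double pole and
    \<open>\<epsilon>\<close> absorbs the pole in \<open>\<epsilon>\<close>; what remains is the
    denominator of \<open>K\<close>.\<close>
  have red: "X / T + \<epsilon> * p\<^sup>2 / T * (- (T * E / p\<^sup>2) / (\<epsilon> * T * r)) = (X * r - E) / (T * r)"
    if "p \<noteq> 0" for X E p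
    using nz(1,2) nz' that by (simp add: field_simps power2_eq_square)
  show ?A
    unfolding H_def K_def d hy_def[symmetric]
    unfolding hy p_def[symmetric] r_def[symmetric] red[OF nz'(1)]
    unfolding Ey_def r_def g_def X Z
    by (rule arg_cong[where f = "\<lambda>a. a / _"]) algebra
  show ?C
    unfolding H_def K_def d hw_def[symmetric]
    unfolding hw p_def[symmetric] q_def[symmetric] r_def[symmetric] red[OF nz'(2)]
    unfolding Ew_def r_def g_def h_def X Z
    by (rule arg_cong[where f = "\<lambda>a. a / _"]) algebra
  have x2: "T + 2 * x - 1 = T + (X + T) / p" "2 * x - (1 - \<epsilon> * T) = (X + T * g) / p"
      "2 * x - 1 - (1 - \<epsilon> * T) = T * (1 + g) / p"
    and z2: "2 * z - 1 = (Z + T) / q" "2 * z - (1 - \<epsilon> * T) = (Z + T * h) / q"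
      "2 * z - 1 - (1 - \<epsilon> * T) = T * (1 + h) / q"
    unfolding x z X Z g_def h_def using nz' by (auto simp: field_simps)
  define hx where "hx = (let t = 1 - \<epsilon> * T in
        y\<^sup>2 * ((x - 1) * x + (x - t) * x + (x - t) * (x - 1))
        + (T + 2 * x - 1 - (A3 + A5 - A1) * (2 * x - t) - (A2 + A4) * (2 * x - 1 - t)) * y
        + A1 * (A0 + A1)
        + 2 * y * z * ((z - 1) * w + A3))"
  define Ex where "Ex = (p * Y + A1)\<^sup>2 * (X + g * X + T * g)
    - (p * Y + A1) * (T * p + X + T - (A3 + A5 - A1) * (X + T * g) - (A2 + A4) * T * (1 + g))
    + T * A1 * (A0 + A1) + 2 * p * (p * Y + A1) * Z * W"
  have hx: "hx = Ex / T"
    unfolding hx_def Ex_def Let_def mult.assoc[of _ z] zw x2 unfolding x1 unfolding y x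
    using nz(1,2) nz' by (simp add: field_simps power2_eq_square)
  define hz where "hz = (let t = 1 - \<epsilon> * T in
        w\<^sup>2 * ((z - 1) * z + (z - t) * z + (z - t) * (z - 1))
        + (T - (A2 - 1) * (2 * z - 1) - (A5 - A1 - A2 - A3) * (2 * z - t) - A4 * (2 * z - 1 - t)) * w
        + A3 * (A0 + 2 * A1 + A2 + A3)
        + 2 * (x - t) * y * ((2 * z - 1) * w + A3))"
  define Ez where "Ez = (q * W + A3)\<^sup>2 * (Z + h * Z + T * h)
    - (q * W + A3) * (T * q - (A2 - 1) * (Z + T) - (A5 - A1 - A2 - A3) * (Z + T * h) - A4 * T * (1 + h))
    + T * A3 * (A0 + 2 * A1 + A2 + A3) + 2 * g * (p * Y + A1) * ((Z + T) * (q * W + A3) - T * A3)"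
  have hz: "hz = Ez / T"
    unfolding hz_def Ez_def Let_def z2(2,3) unfolding x1 z1 z2(1) unfolding y w z
    using nz(1,2) nz' by (simp add: field_simps power2_eq_square)
  \<comment> \<open>In the equations for \<open>Y\<close> and \<open>W\<close> a double pole
    survives the Jacobian, so the second premise asks for divisibility by \<open>p\<^sup>2\<close>,
    with \<open>- G\<close> as the quotient.\<close>
  have red': "- Y / T - \<epsilon> * (2 * p * Y + A) / T * (- (T * E / p\<^sup>2) / (\<epsilon> * T * r))
      + \<epsilon> * T / p\<^sup>2 * - (- (F / T) / (\<epsilon> * T * r)) = - (G / (T * r))"
    if "p \<noteq> 0" "(2 * p * Y + A) * E + F - Y * r * p\<^sup>2 = - G * p\<^sup>2" for Y A E F G p
  proof -
    have "- Y / T - \<epsilon> * (2 * p * Y + A) / T * (- (T * E / p\<^sup>2) / (\<epsilon> * T * r))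
      + \<epsilon> * T / p\<^sup>2 * - (- (F / T) / (\<epsilon> * T * r)) =
      ((2 * p * Y + A) * E + F - Y * r * p\<^sup>2) / (p\<^sup>2 * (T * r))"
      using nz(1,2) nz' that(1) by (simp add: field_simps power2_eq_square)
    then show ?thesis
      unfolding that(2) using nz(1,2) nz' that(1) by (simp add: field_simps)
  qed
  \<comment> \<open>The normalisation enters here: at \<open>p = 0\<close> the left side of the
    premise of \<open>red'\<close> is \<open>T * A1\<close> times the sum of all \<open>Ai\<close>
    minus 1, and for the second pair, at \<open>q = 0\<close>, the factor is
    \<open>T * A3\<close>.\<close>
  have A0: "A0 = 1 - A1 - A2 - A3 - A4 - A5"
    using sum by algebra
  show ?B
    unfolding H_def K_def d hx_def[symmetric] hy_def[symmetric]
    unfolding hx hy p_def[symmetric] r_def[symmetric]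
    by (rule red'[OF nz'(1), symmetric], unfold Ex_def Ey_def r_def g_def X Z A0) algebra
  show ?D
    unfolding H_def K_def d hz_def[symmetric] hw_def[symmetric]
    unfolding hz hw p_def[symmetric] q_def[symmetric] r_def[symmetric]
    by (rule red'[OF nz'(2), symmetric], unfold Ez_def Ew_def r_def g_def h_def X Z A0) algebra
qed

text \<open>\<open>K\<close> is chosen before \<open>\<epsilon>\<close>, \<open>U\<close> and the
  curves, so one family serves all solutions and the limit. Its holomorphy ensures that the total
  operator \<open>deriv\<close> yields genuine partial derivatives.\<close>

theorem theorem2p11:
  fixes A0 A1 A2 A3 A4 A5 :: complex
  assumes "A0 + A1 + A2 + A3 + A4 + A5 = 1"
  shows "\<exists>K :: complex \<Rightarrow> complex \<Rightarrow> complex \<Rightarrow> complex \<Rightarrow> complex \<Rightarrow> complex \<Rightarrow> complex.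
    (\<forall>\<epsilon>. \<epsilon> \<noteq> 0 \<longrightarrow> holomorphic_hamiltonian (K \<epsilon>) {T. T \<noteq> 0 \<and> \<epsilon> * T \<noteq> 1}) \<and>
    (\<forall>\<epsilon> \<alpha>0 \<alpha>1 \<alpha>2 \<alpha>4 \<beta>2 \<beta>3 \<beta>4 U x y z w X Y Z W.
       \<epsilon> \<noteq> 0 \<and>
       S_parameters \<alpha>0 \<alpha>1 \<alpha>2 \<alpha>4 \<beta>2 \<beta>3 \<beta>4 \<and>
       change_of_parameters A0 A1 A2 A3 A4 A5 \<epsilon> \<alpha>0 \<alpha>1 \<alpha>2 \<alpha>4 \<beta>2 \<beta>3 \<beta>4 \<and>
       open U \<and> U \<subseteq> {T. T \<noteq> 0 \<and> \<epsilon> * T \<noteq> 1} \<and>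
       (\<forall>T\<in>U. X T \<noteq> T \<and> Z T \<noteq> T \<and>
          (let t = 1 - \<epsilon> * T in change_of_variables A1 A3 \<epsilon> t (x t) (y t) (z t) (w t) T (X T) (Y T) (Z T) (W T))) \<longrightarrow>
       (hamiltonian_solution (H_S \<alpha>0 \<alpha>1 \<alpha>2 \<alpha>4 \<beta>2 \<beta>3 \<beta>4) ((\<lambda>T. 1 - \<epsilon> * T) ` U) x y z w \<longleftrightarrow>
        hamiltonian_solution (K \<epsilon>) U X Y Z W)) \<and>
    (\<forall>T X Y Z W. T \<noteq> 0 \<longrightarrow>
       ((\<lambda>\<epsilon>. deriv (\<lambda>\<eta>. K \<epsilon> T X \<eta> Z W) Y) \<longlongrightarrow> A5_rhs_X A1 A2 A3 A4 A5 T X Y Z W) (at 0) \<and>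
       ((\<lambda>\<epsilon>. - deriv (\<lambda>\<xi>. K \<epsilon> T \<xi> Y Z W) X) \<longlongrightarrow> A5_rhs_Y A1 A2 A3 A4 A5 T X Y Z W) (at 0) \<and>
       ((\<lambda>\<epsilon>. deriv (\<lambda>\<omega>. K \<epsilon> T X Y Z \<omega>) W) \<longlongrightarrow> A5_rhs_Z A1 A2 A3 A4 A5 T X Y Z W) (at 0) \<and>
       ((\<lambda>\<epsilon>. - deriv (\<lambda>\<zeta>. K \<epsilon> T X Y \<zeta> W) Z) \<longlongrightarrow> A5_rhs_W A1 A2 A3 A4 A5 T X Y Z W) (at 0))"
proof (intro exI[of _ "confluent_hamiltonian A1 A2 A3 A4 A5"] conjI allI impI)
  fix \<epsilon> \<alpha>0 \<alpha>1 \<alpha>2 \<alpha>4 \<beta>2 \<beta>3 \<beta>4 U x y z w X Y Z W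
  assume *: "\<epsilon> \<noteq> 0 \<and>
       S_parameters \<alpha>0 \<alpha>1 \<alpha>2 \<alpha>4 \<beta>2 \<beta>3 \<beta>4 \<and>
       change_of_parameters A0 A1 A2 A3 A4 A5 \<epsilon> \<alpha>0 \<alpha>1 \<alpha>2 \<alpha>4 \<beta>2 \<beta>3 \<beta>4 \<and>
       open U \<and> U \<subseteq> {T. T \<noteq> 0 \<and> \<epsilon> * T \<noteq> 1} \<and>
       (\<forall>T\<in>U. X T \<noteq> T \<and> Z T \<noteq> T \<and>
          (let t = 1 - \<epsilon> * T in change_of_variables A1 A3 \<epsilon> t (x t) (y t) (z t) (w t) T (X T) (Y T) (Z T) (W T)))"
  then have \<epsilon>: "\<epsilon> \<noteq> 0" and U: "open U" "\<And>T. T \<in> U \<Longrightarrow> T \<noteq> 0 \<and> \<epsilon> * T \<noteq> 1"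
    by auto
  have params: "\<alpha>0 = inverse \<epsilon>" "\<alpha>1 = A0" "\<alpha>2 = A1" "\<alpha>4 = A2 + A4" "\<beta>2 = A3"
      "\<beta>3 = - inverse \<epsilon> - (A1 + A2 + A3 - A5)" "\<beta>4 = A4"
    using * by (auto simp: change_of_parameters_def algebra_simps)
  have cv: "X T \<noteq> T" "Z T \<noteq> T" "change_of_variables A1 A3 \<epsilon> (1 - \<epsilon> * T) (x (1 - \<epsilon> * T)) (y (1 - \<epsilon> * T))
      (z (1 - \<epsilon> * T)) (w (1 - \<epsilon> * T)) T (X T) (Y T) (Z T) (W T)" if "T \<in> U" for T
    using * that by (auto simp: Let_def)
  have xy: "s \<noteq> 0 \<and> X s \<noteq> s \<and> x (1 - \<epsilon> * s) = X s / (X s - s) \<and>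
      y (1 - \<epsilon> * s) = - ((X s - s) * ((X s - s) * Y s + A1) / s)"
    and zw: "s \<noteq> 0 \<and> Z s \<noteq> s \<and> z (1 - \<epsilon> * s) = Z s / (Z s - s) \<and>
      w (1 - \<epsilon> * s) = - ((Z s - s) * ((Z s - s) * W s + A3) / s)" if "s \<in> U" for s
    using U(2)[OF that] cv[OF that] by (auto simp: change_of_variables_def)
  show "hamiltonian_solution (H_S \<alpha>0 \<alpha>1 \<alpha>2 \<alpha>4 \<beta>2 \<beta>3 \<beta>4) ((\<lambda>T. 1 - \<epsilon> * T) ` U) x y z w \<longleftrightarrow>
        hamiltonian_solution (confluent_hamiltonian A1 A2 A3 A4 A5 \<epsilon>) U X Y Z W"
    unfolding hamiltonian_solution_def ball_simps params
  proof (rule ball_cong[OF refl], goal_cases)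
    case (1 T)
    note field = vector_field_change_of_variables[OF assms \<epsilon> _ cv(1,2)[OF 1] _ cv(3)[OF 1]]
    have T: "T \<noteq> 0" "\<epsilon> * T \<noteq> 1"
      using U(2)[OF 1] by auto
    \<comment> \<open>The four equations split into two canonical pairs: each pair is transformed by
      itself, and the coupling is felt only in the values of the velocities.\<close>
    have conj4: "P \<and> Q \<and> R \<and> S \<longleftrightarrow> P' \<and> Q' \<and> R' \<and> S'"
      if "P \<and> Q \<longleftrightarrow> P' \<and> Q'" "R \<and> S \<longleftrightarrow> R' \<and> S'" for P Q R S P' Q' R' S'
      using that by blast
    show ?case
      unfolding field[OF T]
      by (rule conj4; rule derivatives_change_of_variables[OF \<epsilon> U(1) 1]; fact xy zw)
  qed
qed (rule holomorphic_confluent_hamiltonian, (erule confluent_hamiltonian_limit)+)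

end
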